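(* Consider the following process on the cycle with $n\ge 3$ nodes $1,\dots,n$ (node $i$ adjacent to $i-1$ and $i+1$, indices modulo $n$). Each node $i$ carries a real load $x_i(t)$, and initially all loads are equal. At each step $t=0,1,2,\dots$, an edge $\{i,i+1\}$ is chosen uniformly at random among the $n$ cycle edges and a weight $w(t)$ is drawn from a fixed real distribution $W$ with $\mathbb{E}[W^2]\le 1$, independently of everything else; then $x_i(t+1)=x_{i+1}(t+1)=\frac{x_i(t)+x_{i+1}(t)+w(t)}{2}$, and all other loads are unchanged. Let $Gap(t)=\max_{1\le i\le n}x_i(t)-\min_{1\le i\le n}x_i(t)$. Then for every $t\ge 0$, \[\mathbb{E}[Gap(t)]=O(\sqrt{n}\log n),\] i.e. there is an absolute constant $C$ (independent of $n$, $t$ and $W$) with $\mathbb{E}[Gap(t)]\le C\sqrt{n}\log n$.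
   Context: The edge choice and the weight are independent across steps and independent of the current loads. *)

theory Defs
  imports "HOL-Probability.Probability"
begin

text \<open>
  The nodes of the cycle are \<open>0, \<dots>, n - 1\<close>, and the edge \<open>{i, i + 1 mod n}\<close> is
  identified with \<open>i\<close>, so the \<open>n\<close> edges are also indexed by \<open>{..<n}\<close>.
\<close>

definition balance :: "nat \<Rightarrow> nat \<Rightarrow> real \<Rightarrow> (nat \<Rightarrow> real) \<Rightarrow> (nat \<Rightarrow> real)" where
  "balance n i w x =
     (let a = (x i + x (Suc i mod n) + w) / 2 in x(i := a, Suc i mod n := a))"

text \<open>
  A sample point \<open>\<omega>\<close> lists, for every step, the chosen edge and the drawn weight;
  \<open>c\<close> is the common initial load.
\<close>

primrec load :: "nat \<Rightarrow> real \<Rightarrow> (nat \<Rightarrow> nat \<times> real) \<Rightarrow> nat \<Rightarrow> (nat \<Rightarrow> real)" where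
  "load n c \<omega> 0 = (\<lambda>_. c)"
| "load n c \<omega> (Suc t) = balance n (fst (\<omega> t)) (snd (\<omega> t)) (load n c \<omega> t)"

definition gap :: "nat \<Rightarrow> real \<Rightarrow> nat \<Rightarrow> (nat \<Rightarrow> nat \<times> real) \<Rightarrow> real" where
  "gap n c t \<omega> = Max (load n c \<omega> t ` {..<n}) - Min (load n c \<omega> t ` {..<n})"

text \<open>
  The product measures make the edge and the weight of a step independent of each other
  and of all other steps, hence of the current loads.
\<close>

definition cycle_process :: "nat \<Rightarrow> real measure \<Rightarrow> (nat \<Rightarrow> nat \<times> real) measure" where
  "cycle_process n W =
     (\<Pi>\<^sub>M t\<in>UNIV. measure_pmf (pmf_of_set {..<n}) \<Otimes>\<^sub>M W)"

end

theory Submission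
  imports Defs
begin

text \<open>
  For a load vector \<open>x\<close> let \<open>hop n x k\<close> be the sum of \<open>(x\<^sub>i\<^sub>+\<^sub>k - x\<^sub>i)\<^sup>2\<close> over the cycle.
  Averaging over the edge, the vector of all hop sums follows an affine recursion
  \<open>d \<mapsto> L d + w\<^sup>2 b\<close> in which the mean of the weight cancels; its fixed point is \<open>k (n - k) - 1\<close>.
  The map \<open>L\<close> is not monotone, but it preserves nonnegativity on hop sums of actual load vectors.
  The fixed point is the hop sum of the sawtooth \<open>i \<mapsto> i\<close>, divided by \<open>n\<close>, minus half the hop sum
  of a point mass, and balancing does not increase sums of squares; hence starting from equal
  loads the expected hop sums never exceed \<open>k (n - k) + 1\<close>. Dyadic chaining around the
  cycle then costs \<open>O(sqrt n)\<close> on each of \<open>O(log n)\<close> scales.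
\<close>

subsection \<open>Correlations and hop sums under one balancing step\<close>

lemma sum_shift_periodic:
  fixes F :: "nat \<Rightarrow> 'a::ab_group_add"
  assumes "\<And>i. F (i + n) = F i"
  shows "(\<Sum>i<n. F (i + a)) = (\<Sum>i<n. F i)"
proof (induction a)
  case (Suc a)
  have "(\<Sum>i<n. F (i + Suc a)) = (\<Sum>i<Suc n. F (i + a)) - F a"
    by (subst sum.lessThan_Suc_shift) simp
  also have "\<dots> = (\<Sum>i<n. F (i + a))"
    using assms[of a] by (simp add: add.commute)
  finally show ?case using Suc by simp
qed simp

lemma mod_add_self_mid: "(i + n + c) mod n = (i + c) mod n" for n :: nat
  using mod_add_self2[of "i + c" n] by (simp only: ac_simps)

text \<open>Cyclic autocorrelation. It is bilinear, so changing two loads expands directly, and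
  \<open>hop_eq_corr\<close> recovers the hop sums from it.\<close>

definition corr :: "nat \<Rightarrow> (nat \<Rightarrow> real) \<Rightarrow> nat \<Rightarrow> real" where
  "corr n x k = (\<Sum>i<n. x i * x ((i + k) mod n))"

text \<open>The cutoff makes \<open>hop n x\<close> vanish off \<open>0 < k < n\<close>, as
  \<open>hop_step\<close> and \<open>hop_noise\<close> do; the recursion is then an identity of
  functions and can be iterated.\<close>

definition hop :: "nat \<Rightarrow> (nat \<Rightarrow> real) \<Rightarrow> nat \<Rightarrow> real" where
  "hop n x k = (if k < n then \<Sum>i<n. (x ((i + k) mod n) - x i)\<^sup>2 else 0)"

lemma corr_shift:
  "(\<Sum>e<n. x ((e + a) mod n) * x ((e + a + c) mod n)) = corr n x c"
proof -
  have "(\<Sum>e<n. x ((e + a) mod n) * x ((e + a + c) mod n))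
      = (\<Sum>e<n. x (e mod n) * x ((e + c) mod n))"
    by (rule sum_shift_periodic[where F = "\<lambda>e. x (e mod n) * x ((e + c) mod n)"])
       (simp add: mod_add_self_mid)
  then show ?thesis by (simp add: corr_def)
qed

lemma corr_sym:
  assumes "k \<le> n"
  shows "corr n x (n - k) = corr n x k"
proof -
  have "corr n x (n - k) = (\<Sum>e<n. x ((e + k) mod n) * x ((e + k + (n - k)) mod n))"
    by (rule corr_shift[symmetric])
  also have "\<dots> = corr n x k"
    unfolding corr_def by (rule sum.cong) (use assms in \<open>auto simp: mult.commute add.assoc\<close>)
  finally show ?thesis .
qed

text \<open>Expanding the square gives the case \<open>k < n\<close>. The endpoint
  \<open>k = n\<close>, where both sides vanish, serves as the neighbour of \<open>n - 1\<close> in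
  the second difference.\<close>

lemma hop_eq_corr:
  assumes "k \<le> n"
  shows "hop n x k = 2 * corr n x 0 - 2 * corr n x k"
proof (cases "k = n")
  case True
  then show ?thesis using corr_sym[of 0 n x] by (simp add: hop_def)
next
  case False
  then have k: "k < n" using assms by simp
  have "(\<Sum>i<n. x ((i + k) mod n) * x ((i + k) mod n)) = corr n x 0"
    using corr_shift[of x k n 0] by simp
  moreover have "(\<Sum>i<n. x i * x i) = corr n x 0" by (simp add: corr_def)
  moreover have "hop n x k = (\<Sum>i<n. x ((i + k) mod n) * x ((i + k) mod n))
      + (\<Sum>i<n. x i * x i) - 2 * (\<Sum>i<n. x i * x ((i + k) mod n))"
    using k by (simp add: hop_def sum_distrib_left flip: sum.distrib sum_subtractf)
       (rule sum.cong, auto simp: power2_eq_square algebra_simps)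
  moreover have "(\<Sum>i<n. x i * x ((i + k) mod n)) = corr n x k" by (simp add: corr_def)
  ultimately show ?thesis by simp
qed

lemma hop_nonneg: "hop n x k \<ge> 0"
  by (simp add: hop_def sum_nonneg)

lemma hop_le_corr:
  assumes "k < n"
  shows "hop n x k \<le> 4 * corr n x 0"
proof -
  have "(\<Sum>i<n. x ((i + k) mod n) * x ((i + k) mod n)) = corr n x 0"
    using corr_shift[of x k n 0] by simp
  moreover have "(\<Sum>i<n. x i * x i) = corr n x 0" by (simp add: corr_def)
  moreover have "hop n x k \<le> (\<Sum>i<n. 2 * (x ((i + k) mod n) * x ((i + k) mod n)) + 2 * (x i * x i))"
  proof -
    have "(u - v)\<^sup>2 \<le> 2 * (u * u) + 2 * (v * v)" for u v :: real
      using zero_le_power2[of "u + v"] by (simp add: power2_eq_square algebra_simps)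
    then show ?thesis using assms by (simp add: hop_def sum_mono)
  qed
  ultimately show ?thesis by (simp add: sum.distrib flip: sum_distrib_left)
qed

text \<open>Bilinear expansion around \<open>x\<close>. The perturbation meets its own shift with
  product \<open>p * q\<close> only at lags \<open>1\<close> and \<open>n - 1\<close>; these are
  distinct because \<open>n >= 3\<close>, so the product is counted once at each.\<close>

lemma corr_add_two_point:
  fixes p q :: real
  assumes n: "n \<ge> 3" and e: "e < n" and k: "k < n"
    and y: "\<And>i. y i = x i + (if i = e then p else 0) + (if i = Suc e mod n then q else 0)"
  shows "corr n y k = corr n x k
      + p * (x ((e + k) mod n) + x ((e + (n - k)) mod n))
      + q * (x ((e + 1 + k) mod n) + x ((e + 1 + (n - k)) mod n))
      + (if k = 0 then p\<^sup>2 + q\<^sup>2 else 0) + (if k = 1 \<or> k = n - 1 then p * q else 0)"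
proof -
  define h where "h = (\<lambda>i. (if i = e then p else 0) + (if i = Suc e mod n then q else 0))"
  have y_h: "y i = x i + h i" for i by (simp add: y h_def)
  have e': "Suc e mod n < n" using n by simp
  have sum_h: "(\<Sum>i<n. h i * f i) = p * f e + q * f (Suc e mod n)" for f
    using e e' by (simp add: h_def distrib_right sum.distrib if_distrib[of "\<lambda>a. a * _"] sum.delta cong: if_cong)
  have "corr n y k = corr n x k + (\<Sum>i<n. h i * x ((i + k) mod n))
      + (\<Sum>i<n. x i * h ((i + k) mod n)) + (\<Sum>i<n. h i * h ((i + k) mod n))"
    unfolding corr_def sum.distrib[symmetric]
    by (rule sum.cong) (simp_all only: y_h distrib_left distrib_right ac_simps)
  moreover have "(\<Sum>i<n. x i * h ((i + k) mod n)) = (\<Sum>i<n. h i * x ((i + (n - k)) mod n))"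
  proof -
    have "(\<Sum>i<n. x i * h ((i + k) mod n))
        = (\<Sum>i<n. x ((i + k + (n - k)) mod n) * h ((i + k) mod n))"
      by (rule sum.cong) (use k in \<open>auto simp: add.assoc\<close>)
    also have "\<dots> = (\<Sum>i<n. x ((i + (n - k)) mod n) * h (i mod n))"
      by (rule sum_shift_periodic[where F = "\<lambda>i. x ((i + (n - k)) mod n) * h (i mod n)"])
         (simp add: mod_add_self_mid)
    also have "\<dots> = (\<Sum>i<n. h i * x ((i + (n - k)) mod n))"
      by (rule sum.cong) (auto simp: mult.commute)
    finally show ?thesis .
  qed
  moreover have "(\<Sum>i<n. h i * h ((i + k) mod n))
      = (if k = 0 then p\<^sup>2 + q\<^sup>2 else 0) + (if k = 1 \<or> k = n - 1 then p * q else 0)"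
  proof -
    have mod1: "(a + b) mod n = (if a + b < n then a + b else a + b - n)"
      if "a < n" "b < n" for a b
      using that by (simp add: mod_if)
    have E: "Suc e mod n = (if e + 1 < n then e + 1 else 0)"
      using e by (auto simp: mod_if)
    have h1: "h ((e + k) mod n) = (if k = 0 then p else 0) + (if k = 1 then q else 0)"
      unfolding h_def E mod1[OF e k] using n e k by (auto split: if_splits)
    have h2: "h ((Suc e mod n + k) mod n) = (if k = 0 then q else 0) + (if k = n - 1 then p else 0)"
      unfolding h_def mod1[OF e' k] unfolding E using n e k by (auto split: if_splits)
    show ?thesis
      unfolding sum_h h1 h2 using n by (auto simp: power2_eq_square)
  qed
  moreover have m: "(Suc e mod n + j) mod n = (e + 1 + j) mod n" for j
    by (simp add: mod_add_left_eq)
  ultimately show ?thesis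
    unfolding sum_h m by (simp only: distrib_left ac_simps)
qed

lemma balance_eq_add:
  assumes "n \<ge> 2" "e < n"
  shows "balance n e w x i = x i
     + (if i = e then (x (Suc e mod n) - x e + w) / 2 else 0)
     + (if i = Suc e mod n then (x e - x (Suc e mod n) + w) / 2 else 0)"
proof -
  have "e \<noteq> Suc e mod n" using assms by (auto simp: mod_if)
  then show ?thesis by (auto simp: balance_def Let_def field_simps)
qed

text \<open>Summing over all edges turns each product of loads into a correlation at lag
  \<open>k - 1\<close>, \<open>k\<close> or \<open>k + 1\<close>, and together they form a discrete
  Laplacian. The part linear in \<open>w\<close> is the same at every lag, so it cancels in hop
  sums.\<close>

lemma
  assumes n: "n \<ge> 3"
  shows sum_corr_balance: "\<lbrakk>0 < k; k < n\<rbrakk> \<Longrightarrow> (\<Sum>e<n. corr n (balance n e w x) k) = real n * corr n x k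
      + (corr n x (k + 1) + corr n x (k - 1) - 2 * corr n x k) + 2 * w * (\<Sum>i<n. x i)
      + (if k = 1 \<or> k = n - 1 then (real n * w\<^sup>2 - hop n x 1) / 4 else 0)" (is "_ \<Longrightarrow> _ \<Longrightarrow> ?thesis1")
    and sum_corr_balance_0:
     "(\<Sum>e<n. corr n (balance n e w x) 0) = real n * corr n x 0
      + 2 * w * (\<Sum>i<n. x i) + (real n * w\<^sup>2 - hop n x 1) / 2" (is ?thesis2)
proof -
  define X where "X = (\<lambda>i. x (i mod n))"
  define p where "p = (\<lambda>e. (X (e + 1) - X e + w) / 2)"
  define q where "q = (\<lambda>e. (X e - X (e + 1) + w) / 2)"
  have XX: "(\<Sum>e<n. X (e + a) * X (e + a + c)) = corr n x c" for a c
    unfolding X_def by (rule corr_shift)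
  have XS: "(\<Sum>e<n. X (e + a)) = (\<Sum>i<n. x i)" for a
    using sum_shift_periodic[of X n a] by (simp add: X_def)
  have edge: "corr n (balance n e w x) k = corr n x k
      + p e * (X (e + k) + X (e + (n - k)))
      + q e * (X (e + 1 + k) + X (e + 1 + (n - k)))
      + (if k = 0 then (p e)\<^sup>2 + (q e)\<^sup>2 else 0) + (if k = 1 \<or> k = n - 1 then p e * q e else 0)"
    if "e < n" "k < n" for e k
    unfolding p_def q_def X_def
    using corr_add_two_point[OF n that balance_eq_add[of n e w x]] n that by simp
  have hop1: "hop n x (Suc 0) = (\<Sum>e<n. (X (e + 1) - X e)\<^sup>2)"
    using n by (auto simp: hop_def X_def)
  \<comment> \<open>The increments are half of \<open>w\<close> plus and minus half the edge
    difference, so their product is a difference of squares.\<close>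
  have pq: "(\<Sum>e<n. p e * q e) = (real n * w\<^sup>2 - hop n x 1) / 4"
  proof -
    have "p e * q e = w\<^sup>2 / 4 - (X (e + 1) - X e)\<^sup>2 / 4" for e
      by (simp add: p_def q_def power2_eq_square field_simps)
    then show ?thesis
      using hop1 by (simp add: sum_subtractf diff_divide_distrib sum_divide_distrib)
  qed
  have pq2: "(\<Sum>e<n. (p e)\<^sup>2 + (q e)\<^sup>2) = (real n * w\<^sup>2 + hop n x 1) / 2"
  proof -
    have "(p e)\<^sup>2 + (q e)\<^sup>2 = w\<^sup>2 / 2 + (X (e + 1) - X e)\<^sup>2 / 2" for e
      by (simp add: p_def q_def power2_eq_square field_simps)
    then show ?thesis
      using hop1 by (simp add: sum.distrib add_divide_distrib sum_divide_distrib)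
  qed
  have lin: "(\<Sum>e<n. p e * (X (e + k) + X (e + (n - k)))
      + q e * (X (e + 1 + k) + X (e + 1 + (n - k))))
      = (corr n x (k + 1) + corr n x (k - 1) - 2 * corr n x k) + 2 * w * (\<Sum>i<n. x i)"
    if k: "0 < k" "k < n" for k
  proof -
    have c1: "(\<Sum>e<n. X (e + 1) * X (e + k)) = corr n x (k - 1)"
      using XX[of 1 "k - 1"] k by simp
    have c2: "(\<Sum>e<n. X e * X (e + k)) = corr n x k"
      using XX[of 0 k] by simp
    have c3: "(\<Sum>e<n. X (e + 1) * X (e + (n - k))) = corr n x (k + 1)"
    proof -
      have "e + 1 + (n - (k + 1)) = e + (n - k)" for e using k by simp
      then show ?thesis using XX[of 1 "n - (k + 1)"] corr_sym[of "k + 1" n x] k by simp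
    qed
    have c4: "(\<Sum>e<n. X e * X (e + (n - k))) = corr n x k"
      using XX[of 0 "n - k"] corr_sym[of k n x] k by simp
    have c5: "(\<Sum>e<n. X e * X (e + 1 + k)) = corr n x (k + 1)"
      using XX[of 0 "k + 1"] by simp
    have c6: "(\<Sum>e<n. X (e + 1) * X (e + 1 + k)) = corr n x k"
      using XX[of 1 k] by simp
    have c7: "(\<Sum>e<n. X e * X (e + 1 + (n - k))) = corr n x (k - 1)"
    proof -
      have "e + 0 + (n - (k - 1)) = e + 1 + (n - k)" for e using k by simp
      then show ?thesis using XX[of 0 "n - (k - 1)"] corr_sym[of "k - 1" n x] k by simp
    qed
    have c8: "(\<Sum>e<n. X (e + 1) * X (e + 1 + (n - k))) = corr n x k"
      using XX[of 1 "n - k"] corr_sym[of k n x] k by simp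
    have "(\<Sum>e<n. p e * (X (e + k) + X (e + (n - k)))
      + q e * (X (e + 1 + k) + X (e + 1 + (n - k))))
      = ((\<Sum>e<n. X (e + 1) * X (e + k)) - (\<Sum>e<n. X e * X (e + k))
       + (\<Sum>e<n. X (e + 1) * X (e + (n - k))) - (\<Sum>e<n. X e * X (e + (n - k)))
       + (\<Sum>e<n. X e * X (e + 1 + k)) - (\<Sum>e<n. X (e + 1) * X (e + 1 + k))
       + (\<Sum>e<n. X e * X (e + 1 + (n - k))) - (\<Sum>e<n. X (e + 1) * X (e + 1 + (n - k)))
       + w * ((\<Sum>e<n. X (e + k)) + (\<Sum>e<n. X (e + (n - k)))
          + (\<Sum>e<n. X (e + (1 + k))) + (\<Sum>e<n. X (e + (1 + (n - k)))))) / 2"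
      unfolding sum_distrib_left sum_divide_distrib
        sum.distrib[symmetric] sum_subtractf[symmetric]
      by (rule sum.cong) (simp_all add: p_def q_def field_simps)
    also have "\<dots> = (corr n x (k + 1) + corr n x (k - 1) - 2 * corr n x k) + 2 * w * (\<Sum>i<n. x i)"
      unfolding c1 c2 c3 c4 c5 c6 c7 c8 XS by (simp add: field_simps)
    finally show ?thesis .
  qed
  show ?thesis1 if k: "0 < k" "k < n"
  proof -
    have "(\<Sum>e<n. corr n (balance n e w x) k) = (\<Sum>e<n. corr n x k
        + (p e * (X (e + k) + X (e + (n - k)))
        + q e * (X (e + 1 + k) + X (e + 1 + (n - k))))
        + (if k = 1 \<or> k = n - 1 then p e * q e else 0))"
      by (rule sum.cong) (use edge k in auto)
    also have "\<dots> = real n * corr n x k + (\<Sum>e<n. p e * (X (e + k) + X (e + (n - k)))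
        + q e * (X (e + 1 + k) + X (e + 1 + (n - k))))
        + (if k = 1 \<or> k = n - 1 then \<Sum>e<n. p e * q e else 0)"
      by (simp add: sum.distrib)
    finally show ?thesis unfolding lin[OF k] pq by (simp only: add.assoc)
  qed
  have X_n: "X (e + n) = X e" for e by (simp add: X_def)
  have "(\<Sum>e<n. corr n (balance n e w x) 0) = (\<Sum>e<n. corr n x 0
      + (2 * p e * X e + 2 * q e * X (e + 1)) + ((p e)\<^sup>2 + (q e)\<^sup>2))"
    by (rule sum.cong) (use edge[of _ 0] n in \<open>auto simp: X_n X_n[of "Suc _", simplified]\<close>)
  also have "\<dots> = real n * corr n x 0 + (\<Sum>e<n. 2 * p e * X e + 2 * q e * X (e + 1))
     + (real n * w\<^sup>2 + hop n x 1) / 2"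
    unfolding pq2[symmetric] by (simp add: sum.distrib)
  also have "(\<Sum>e<n. 2 * p e * X e + 2 * q e * X (e + 1))
     = (\<Sum>e<n. w * X (e + 0) + w * X (e + 1) - (X (e + 1) - X e)\<^sup>2)"
    by (rule sum.cong) (simp_all add: p_def q_def field_simps power2_eq_square)
  also have "\<dots> = 2 * w * (\<Sum>i<n. x i) - hop n x 1"
    by (simp only: sum.distrib sum_subtractf sum_distrib_left[symmetric] XS hop1 One_nat_def)
  finally show ?thesis2 by (simp add: field_simps)
qed

subsection \<open>Evolution of the hop sums\<close>

text \<open>
  Averaged over the chosen edge, the hop sums evolve by the linear map \<open>hop_step\<close> plus \<open>w\<^sup>2\<close>
  times \<open>hop_noise\<close>; the weight \<open>1 / 2\<close> accounts for the one edge whose balancing moves both ends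
  of an adjacent pair.
\<close>

definition hop_noise :: "nat \<Rightarrow> nat \<Rightarrow> real" where
  "hop_noise n k = (if 0 < k \<and> k < n then if k = 1 \<or> k = n - 1 then 1 / 2 else 1 else 0)"

definition hop_step :: "nat \<Rightarrow> (nat \<Rightarrow> real) \<Rightarrow> nat \<Rightarrow> real" where
  "hop_step n d k =
     (if 0 < k \<and> k < n
      then d k + (d (k + 1) + d (k - 1) - 2 * d k - hop_noise n k * d 1) / real n else 0)"

text \<open>Subtracting twice the lag-\<open>k\<close> identity from twice the lag-0 one cancels the
  terms linear in \<open>w\<close>, so the mean of the weight never enters. The factor of
  \<open>real n * w^2 - hop n x 1\<close> is \<open>2 * (1/2)\<close>, lowered by
  \<open>2 * (1/4)\<close> at the two end lags, which is \<open>hop_noise\<close>.\<close>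

lemma avg_hop_balance:
  assumes n: "n \<ge> 3"
  shows "(\<Sum>e<n. hop n (balance n e w x) k) / real n = hop_step n (hop n x) k + w\<^sup>2 * hop_noise n k"
proof (cases "0 < k \<and> k < n")
  case True
  then have k: "0 < k" "k < n" by auto
  have "(\<Sum>e<n. hop n (balance n e w x) k)
      = 2 * (\<Sum>e<n. corr n (balance n e w x) 0) - 2 * (\<Sum>e<n. corr n (balance n e w x) k)"
    using k by (simp add: hop_eq_corr sum_subtractf sum_distrib_left)
  also have "\<dots> = real n * (2 * corr n x 0 - 2 * corr n x k)
      - 2 * (corr n x (k + 1) + corr n x (k - 1) - 2 * corr n x k)
      + hop_noise n k * (real n * w\<^sup>2 - hop n x 1)"
    unfolding sum_corr_balance[OF n k] sum_corr_balance_0[OF n]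
    using k by (simp add: hop_noise_def field_simps)
  also have "\<dots> = real n * hop n x k
      + (hop n x (k + 1) + hop n x (k - 1) - 2 * hop n x k)
      + hop_noise n k * (real n * w\<^sup>2 - hop n x 1)"
  proof -
    have "hop n x k = 2 * corr n x 0 - 2 * corr n x k"
      "hop n x (k + 1) = 2 * corr n x 0 - 2 * corr n x (k + 1)"
      "hop n x (k - 1) = 2 * corr n x 0 - 2 * corr n x (k - 1)"
      using k by (auto intro!: hop_eq_corr)
    then show ?thesis by (simp only:) (simp add: algebra_simps)
  qed
  finally show ?thesis using k n by (simp add: hop_step_def field_simps)
next
  case False
  then show ?thesis using n by (auto simp: hop_step_def hop_noise_def hop_def)
qed

lemma hop_step_sum:
  "hop_step n (\<lambda>k. \<Sum>e\<in>A. d e k) = (\<lambda>k. \<Sum>e\<in>A. hop_step n (d e) k)"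
  by (rule ext) (simp add: hop_step_def sum.distrib sum_subtractf sum_distrib_left
      diff_divide_distrib add_divide_distrib sum_divide_distrib)

lemma hop_step_lin:
  "hop_step n (\<lambda>k. a * d k + b * d' k) = (\<lambda>k. a * hop_step n d k + b * hop_step n d' k)"
  by (rule ext) (simp add: hop_step_def algebra_simps diff_divide_distrib add_divide_distrib)

lemma funpow_hop_step_sum:
  "(hop_step n ^^ t) (\<lambda>k. \<Sum>e\<in>A. d e k) = (\<lambda>k. \<Sum>e\<in>A. (hop_step n ^^ t) (d e) k)"
  by (induction t) (simp_all add: hop_step_sum)

lemma funpow_hop_step_lin:
  "(hop_step n ^^ t) (\<lambda>k. a * d k + b * d' k)
    = (\<lambda>k. a * (hop_step n ^^ t) d k + b * (hop_step n ^^ t) d' k)"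
  by (induction t) (simp_all add: hop_step_lin)

lemma avg_funpow_hop_balance:
  assumes n: "n \<ge> 3"
  shows "(\<Sum>e<n. (hop_step n ^^ t) (hop n (balance n e w x)) k) / real n
    = (hop_step n ^^ Suc t) (hop n x) k + w\<^sup>2 * (hop_step n ^^ t) (hop_noise n) k"
proof -
  \<comment> \<open>The zero term \<open>0 * hop_noise n k\<close> gives both sides the two-term
    shape to which \<open>funpow_hop_step_lin\<close> applies.\<close>
  have avg: "(\<lambda>k. (1 / real n) * (\<Sum>e<n. hop n (balance n e w x) k) + 0 * hop_noise n k)
      = (\<lambda>k. 1 * hop_step n (hop n x) k + w\<^sup>2 * hop_noise n k)"
    using avg_hop_balance[OF n, of w x] by auto
  have "(hop_step n ^^ t) (\<lambda>k. (1 / real n) * (\<Sum>e<n. hop n (balance n e w x) k) + 0 * hop_noise n k)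
      = (hop_step n ^^ t) (\<lambda>k. 1 * hop_step n (hop n x) k + w\<^sup>2 * hop_noise n k)"
    unfolding avg ..
  then show ?thesis
    unfolding funpow_hop_step_lin funpow_hop_step_sum funpow_Suc_right comp_def
    by (simp add: fun_eq_iff)
qed

section \<open>Positivity and boundedness on actual hop sums\<close>

lemma funpow_hop_nonneg:
  assumes "n \<ge> 3"
  shows "(hop_step n ^^ t) (hop n x) k \<ge> 0"
proof (induction t arbitrary: x)
  case 0
  then show ?case by (simp add: hop_nonneg)
next
  case (Suc t)
  \<comment> \<open>With weight 0 the noise term drops out, so an iterate on \<open>hop n x\<close>
    is an average of shorter iterates on hop sums of balanced loads, ending in sums of
    squares.\<close>
  have "(hop_step n ^^ Suc t) (hop n x) k
      = (\<Sum>e<n. (hop_step n ^^ t) (hop n (balance n e 0 x)) k) / real n"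
    using avg_funpow_hop_balance[OF assms, of t 0 x k] by simp
  also have "\<dots> \<ge> 0" by (intro divide_nonneg_nonneg sum_nonneg Suc) simp
  finally show ?case .
qed

lemma funpow_hop_const: "(hop_step n ^^ t) (hop n (\<lambda>_. c)) k = 0"
proof -
  have "hop n (\<lambda>_. c) = (\<lambda>k. 0 * hop_noise n k + 0 * hop_noise n k)" by (auto simp: hop_def)
  then show ?thesis by (simp only: funpow_hop_step_lin)
qed

text \<open>\<open>hop_noise\<close> is itself an average of actual hop sums: those produced from
  zero loads by one balancing step of weight 1.\<close>

lemma funpow_hop_noise_nonneg:
  assumes "n \<ge> 3"
  shows "(hop_step n ^^ t) (hop_noise n) k \<ge> 0"
proof -
  have "(hop_step n ^^ t) (hop_noise n) k
      = (\<Sum>e<n. (hop_step n ^^ t) (hop n (balance n e 1 (\<lambda>_. 0))) k) / real n"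
    using avg_funpow_hop_balance[OF assms, of t 1 "\<lambda>_. 0" k]
      funpow_hop_const[of "Suc t" n 0 k] by simp
  also have "\<dots> \<ge> 0" by (intro divide_nonneg_nonneg sum_nonneg funpow_hop_nonneg assms) simp
  finally show ?thesis .
qed

text \<open>Weight-0 balancing does not increase the edge average of \<open>corr n x 0\<close>, the
  sum of squares, and \<open>hop_le_corr\<close> bounds a hop sum by four times it.\<close>

lemma funpow_hop_le_corr:
  assumes n: "n \<ge> 3" and k: "k < n"
  shows "(hop_step n ^^ t) (hop n x) k \<le> 4 * corr n x 0"
proof (induction t arbitrary: x)
  case 0
  then show ?case using hop_le_corr[OF k] by simp
next
  case (Suc t)
  have "(hop_step n ^^ Suc t) (hop n x) k
      = (\<Sum>e<n. (hop_step n ^^ t) (hop n (balance n e 0 x)) k) / real n"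
    using avg_funpow_hop_balance[OF n, of t 0 x k] by simp
  also have "\<dots> \<le> (\<Sum>e<n. 4 * corr n (balance n e 0 x) 0) / real n"
    by (intro divide_right_mono sum_mono Suc) simp
  also have "\<dots> = 4 * (real n * corr n x 0 - hop n x 1 / 2) / real n"
    using sum_corr_balance_0[OF n, of 0 x] by (simp flip: sum_distrib_left)
  also have "\<dots> \<le> 4 * (real n * corr n x 0) / real n"
    using hop_nonneg[of n x 1] by (intro divide_right_mono) auto
  also have "\<dots> = 4 * corr n x 0" using n by simp
  finally show ?case .
qed

section \<open>The stationary profile and a bound uniform in time\<close>

definition hop_stat :: "nat \<Rightarrow> nat \<Rightarrow> real" where
  "hop_stat n k = (if 0 < k \<and> k < n then real k * (real n - real k) - 1 else 0)"

text \<open>The second difference of \<open>hop_stat\<close> is \<open>-2 * hop_noise\<close>: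
  lowering \<open>k (n - k)\<close> by 1 in the interior while keeping 0 at the ends halves it at
  the end lags. With \<open>hop_stat n 1 = n - 2\<close> the increment is
  \<open>- hop_noise * (2 + (n - 2)) / n\<close>.\<close>

lemma hop_step_hop_stat:
  assumes n: "n \<ge> 3"
  shows "hop_step n (hop_stat n) k = hop_stat n k - hop_noise n k"
proof (cases "0 < k \<and> k < n")
  case True
  then have k: "0 < k" "k < n" by auto
  have 1: "hop_stat n 1 = real n - 2" using n by (simp add: hop_stat_def)
  have 2: "hop_stat n (k + 1) + hop_stat n (k - 1) - 2 * hop_stat n k = - 2 * hop_noise n k"
    using k n by (cases "k = 1"; cases "k = n - 1")
      (auto simp: hop_stat_def hop_noise_def of_nat_diff algebra_simps)
  show ?thesis
    using k n unfolding hop_step_def 2 1 by (simp add: field_simps)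
next
  case False
  then show ?thesis by (auto simp: hop_step_def hop_noise_def hop_stat_def)
qed

text \<open>Each application of \<open>hop_step\<close> sheds one iterate of the noise, so the noise
  accumulated up to any \<open>t\<close> is the difference of \<open>hop_stat\<close> and its
  iterate.\<close>

lemma funpow_hop_stat:
  assumes n: "n \<ge> 3"
  shows "(hop_step n ^^ t) (hop_stat n) k = hop_stat n k - (\<Sum>r<t. (hop_step n ^^ r) (hop_noise n) k)"
proof (induction t)
  case (Suc t)
  have eq: "hop_step n (hop_stat n) = (\<lambda>k. 1 * hop_stat n k + (-1) * hop_noise n k)"
    using hop_step_hop_stat[OF n] by auto
  have "(hop_step n ^^ Suc t) (hop_stat n) k
      = (hop_step n ^^ t) (hop_stat n) k - (hop_step n ^^ t) (hop_noise n) k"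
    unfolding funpow_Suc_right comp_def eq funpow_hop_step_lin by simp
  then show ?case using Suc by simp
qed simp

text \<open>Of the \<open>n\<close> differences, \<open>n - k\<close> do not wrap around and equal
  \<open>k\<close>, and the other \<open>k\<close> equal \<open>k - n\<close>.\<close>

lemma hop_sawtooth:
  assumes "k < n"
  shows "hop n real k = real n * (real k * (real n - real k))"
proof -
  have "(\<Sum>i<n. (real ((i + k) mod n) - real i)\<^sup>2)
      = (\<Sum>i<n. if i < n - k then (real k)\<^sup>2 else (real n - real k)\<^sup>2)"
  proof (rule sum.cong)
    fix i assume "i \<in> {..<n}"
    then have "(i + k) mod n = (if i < n - k then i + k else i + k - n)"
      using assms by (auto simp: mod_if)
    then show "(real ((i + k) mod n) - real i)\<^sup>2
        = (if i < n - k then (real k)\<^sup>2 else (real n - real k)\<^sup>2)"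
      using assms by (auto simp: of_nat_diff power2_eq_square algebra_simps)
  qed simp
  also have "\<dots> = real (n - k) * (real k)\<^sup>2 + real k * (real n - real k)\<^sup>2"
  proof -
    have "{..<n} \<inter> {i. i < n - k} = {..<n - k}" "{..<n} \<inter> - {i. i < n - k} = {n - k..<n}"
      by auto
    then show ?thesis using assms by (simp add: sum.If_cases)
  qed
  also have "\<dots> = real n * (real k * (real n - real k))"
    using assms by (simp add: of_nat_diff power2_eq_square algebra_simps)
  finally show ?thesis using assms by (simp add: hop_def)
qed

lemma corr_delta:
  assumes "0 < n" "k < n"
  shows "corr n (\<lambda>i. of_bool (i = 0)) k = of_bool (k = 0)"
proof -
  have "corr n (\<lambda>i. of_bool (i = 0)) k = (\<Sum>i<n. if i = 0 then of_bool (k = 0) else 0)"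
    unfolding corr_def by (rule sum.cong) (use assms in auto)
  then show ?thesis using assms by simp
qed

text \<open>The point mass has hop sum 2 at every \<open>0 < k < n\<close>; half of it supplies the
  \<open>- 1\<close> in \<open>hop_stat\<close>.\<close>

lemma hop_stat_eq:
  "hop_stat n = (\<lambda>k. (1 / real n) * hop n real k + (- 1 / 2) * hop n (\<lambda>i. of_bool (i = 0)) k)"
proof
  fix k
  show "hop_stat n k = (1 / real n) * hop n real k + (- 1 / 2) * hop n (\<lambda>i. of_bool (i = 0)) k"
  proof (cases "k < n")
    case True
    then show ?thesis
      using corr_delta[of n 0] corr_delta[of n k] hop_eq_corr[of k n "\<lambda>i. of_bool (i = 0)"]
      by (auto simp: hop_stat_def hop_sawtooth)
  next
    case False
    then show ?thesis by (simp add: hop_stat_def hop_def)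
  qed
qed

text \<open>
  The left-hand side is \<open>hop_stat n k - (hop_step n ^^ t) (hop_stat n) k\<close>; writing \<open>hop_stat\<close>
  through hop sums of actual load vectors makes the subtracted term at least \<open>-2\<close>,
  although \<open>hop_step\<close> itself is not monotone.
\<close>

lemma sum_funpow_hop_noise_le:
  assumes n: "n \<ge> 3" and k: "0 < k" "k < n"
  shows "(\<Sum>r<t. (hop_step n ^^ r) (hop_noise n) k) \<le> real k * real n"
proof -
  have "(hop_step n ^^ t) (hop_stat n) k = (1 / real n) * (hop_step n ^^ t) (hop n real) k
      + (- 1 / 2) * (hop_step n ^^ t) (hop n (\<lambda>i. of_bool (i = 0))) k"
    unfolding hop_stat_eq funpow_hop_step_lin ..
  moreover have "(1 / real n) * (hop_step n ^^ t) (hop n real) k \<ge> 0"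
    using funpow_hop_nonneg[OF n] by simp
  moreover have "(hop_step n ^^ t) (hop n (\<lambda>i. of_bool (i = 0))) k \<le> 4"
    using funpow_hop_le_corr[OF n k(2), of t "\<lambda>i. of_bool (i = 0)"] corr_delta[of n 0] n by simp
  ultimately have "(hop_step n ^^ t) (hop_stat n) k \<ge> - 2" by simp
  then have "(\<Sum>r<t. (hop_step n ^^ r) (hop_noise n) k) \<le> hop_stat n k + 2"
    using funpow_hop_stat[OF n, of t k] by simp
  also have "\<dots> = real k * real n + 1 - real k * real k"
    using k by (simp add: hop_stat_def algebra_simps)
  also have "\<dots> \<le> real k * real n"
    using k mult_mono[of 1 "real k" 1 "real k"] by simp
  finally show ?thesis .
qed

subsection \<open>Dyadic chaining\<close>

text \<open>Clearing the binary digits of \<open>m\<close> one at a time splits the increment into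
  at most one dyadic step per scale. Its block depends on \<open>m\<close>, so it is dominated by
  the sum over all blocks of that scale; AM-GM with a free parameter \<open>r\<close> replaces
  absolute values by squares.\<close>

lemma abs_diff_le_dyadic:
  fixes X :: "nat \<Rightarrow> real"
  assumes m: "m < 2 ^ J" and r: "r > 0"
  shows "\<bar>X (s + m) - X s\<bar>
    \<le> (\<Sum>j<J. ((\<Sum>l<2 ^ (J - Suc j). (X (s + l * 2 ^ Suc j + 2 ^ j) - X (s + l * 2 ^ Suc j))\<^sup>2) / r + r) / 2)"
proof -
  \<comment> \<open>\<open>a j\<close> is \<open>m\<close> with its lowest \<open>j\<close> binary
    digits cleared.\<close>
  define a where "a = (\<lambda>j. (m div 2 ^ j) * 2 ^ j)"
  have a0: "a 0 = m" and aJ: "a J = 0" using m by (auto simp: a_def)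
  have "X (s + m) - X s = (\<Sum>j<J. X (s + a j) - X (s + a (Suc j)))"
    using sum_lessThan_telescope'[of "\<lambda>j. X (s + a j)" J] a0 aJ by simp
  then have "\<bar>X (s + m) - X s\<bar> \<le> (\<Sum>j<J. \<bar>X (s + a j) - X (s + a (Suc j))\<bar>)"
    by (simp add: sum_abs)
  also have "\<dots> \<le> (\<Sum>j<J. ((\<Sum>l<2 ^ (J - Suc j). (X (s + l * 2 ^ Suc j + 2 ^ j) - X (s + l * 2 ^ Suc j))\<^sup>2) / r + r) / 2)"
  proof (rule sum_mono)
    fix j assume "j \<in> {..<J}"
    then have j: "j < J" by simp
    define l where "l = m div 2 ^ Suc j"
    define f where "f = (\<lambda>l. (X (s + l * 2 ^ Suc j + 2 ^ j) - X (s + l * 2 ^ Suc j))\<^sup>2)"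
    have "(2::nat) ^ J = 2 ^ (J - Suc j) * 2 ^ Suc j"
      using j by (simp only: power_add[symmetric]) simp
    then have l: "l < 2 ^ (J - Suc j)"
      using m unfolding l_def by (intro less_mult_imp_div_less) simp
    have amgm: "\<bar>d\<bar> \<le> (y / r + r) / 2" if "d\<^sup>2 \<le> y" for d y :: real
    proof -
      have "0 \<le> (\<bar>d\<bar> - r)\<^sup>2" by simp
      then have "2 * \<bar>d\<bar> * r \<le> y + r * r"
        using that by (simp add: power2_diff) (simp add: power2_eq_square)
      then show ?thesis using r by (simp add: field_simps)
    qed
    have div2: "m div 2 ^ j = 2 * l + (m div 2 ^ j) mod 2"
      unfolding l_def using div_mult2_eq[of m "2 ^ j" 2] by (simp add: mult.commute)
    have "a (Suc j) = l * 2 ^ Suc j" by (simp add: a_def l_def)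
    moreover have "a j = l * 2 ^ Suc j \<or> a j = l * 2 ^ Suc j + 2 ^ j"
    proof (cases "(m div 2 ^ j) mod 2 = 0")
      case True
      then have "m div 2 ^ j = 2 * l" using div2 by simp
      then show ?thesis by (simp add: a_def)
    next
      case False
      then have "m div 2 ^ j = 2 * l + 1" using div2 by simp
      then show ?thesis by (simp add: a_def algebra_simps)
    qed
    ultimately have "(X (s + a j) - X (s + a (Suc j)))\<^sup>2 \<le> f l"
      by (auto simp: f_def add.assoc)
    also have "f l \<le> (\<Sum>l<2 ^ (J - Suc j). f l)"
      using l by (intro member_le_sum) (auto simp: f_def)
    finally show "\<bar>X (s + a j) - X (s + a (Suc j))\<bar> \<le>
      ((\<Sum>l<2 ^ (J - Suc j). (X (s + l * 2 ^ Suc j + 2 ^ j) - X (s + l * 2 ^ Suc j))\<^sup>2) / r + r) / 2"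
      unfolding f_def by (rule amgm)
  qed
  finally show ?thesis .
qed

text \<open>
  Averaging the chaining bound over all starting points \<open>s\<close> turns the \<open>2 ^ (J - Suc j)\<close>
  increments of scale \<open>2 ^ j\<close> into a \<open>1 / n\<close> fraction of the full hop sum each.
\<close>

lemma max_minus_min_le_hops:
  assumes J: "2 ^ J < 2 * n" "n \<le> 2 ^ J" and r: "r > 0"
  shows "Max (x ` {..<n}) - Min (x ` {..<n})
    \<le> (\<Sum>j<J. 2 ^ (J - Suc j) * hop n x (2 ^ j) / (real n * r) + r)"
proof -
  define X where "X = (\<lambda>i. x (i mod n))"
  define B where "B = (\<lambda>s. \<Sum>j<J. (\<Sum>l<2 ^ (J - Suc j). (X (s + l * 2 ^ Suc j + 2 ^ j) - X (s + l * 2 ^ Suc j))\<^sup>2) / r + r)"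
  have n: "n > 0" using J by (cases n) auto
  have near: "\<bar>x a - X s\<bar> \<le> B s / 2" if "a < n" "s < n" for a s
  proof -
    \<comment> \<open>Forward cyclic distance from \<open>s\<close> to \<open>a\<close>; it is below
      \<open>n <= 2 ^ J\<close>.\<close>
    define m where "m = (if s \<le> a then a - s else a + n - s)"
    have "m < 2 ^ J" using that J by (auto simp: m_def)
    moreover have "X (s + m) = x a" using that by (auto simp: m_def X_def)
    ultimately show ?thesis
      using abs_diff_le_dyadic[of m J r X s] r by (simp add: B_def sum_divide_distrib)
  qed
  have "Max (x ` {..<n}) \<in> x ` {..<n}" "Min (x ` {..<n}) \<in> x ` {..<n}"
    using n by (auto intro!: Max_in Min_in)
  then obtain a b where ab: "a < n" "b < n" "Max (x ` {..<n}) = x a" "Min (x ` {..<n}) = x b"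
    by auto
  \<comment> \<open>Maximum and minimum are both compared with the same load \<open>X s\<close>,
    which cancels.\<close>
  have gap: "x a - x b \<le> B s" if "s < n" for s
    using near[OF ab(1) that] near[OF ab(2) that] by linarith
  have "real n * (x a - x b) = (\<Sum>s<n. x a - x b)" by simp
  also have "\<dots> \<le> (\<Sum>s<n. B s)" by (rule sum_mono) (use gap in auto)
  also have "\<dots> = (\<Sum>j<J. (\<Sum>l<2 ^ (J - Suc j). \<Sum>s<n. (X (s + l * 2 ^ Suc j + 2 ^ j) - X (s + l * 2 ^ Suc j))\<^sup>2) / r + real n * r)"
  proof -
    have "(\<Sum>s<n. (\<Sum>l<L. f s l) / r + r) = (\<Sum>l<L. \<Sum>s<n. f s l) / r + real n * r" for f and L :: nat
      by (subst sum.swap) (simp add: sum.distrib sum_divide_distrib)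
    then show ?thesis unfolding B_def by (subst sum.swap) simp
  qed
  also have "\<dots> = (\<Sum>j<J. 2 ^ (J - Suc j) * hop n x (2 ^ j) / r + real n * r)"
  proof (rule sum.cong)
    fix j assume "j \<in> {..<J}"
    then have "(2::nat) ^ Suc j \<le> 2 ^ J" by (intro power_increasing) auto
    then have j: "2 ^ j < n" using J by simp
    have "(\<Sum>s<n. (X (s + l * 2 ^ Suc j + 2 ^ j) - X (s + l * 2 ^ Suc j))\<^sup>2) = hop n x (2 ^ j)" for l
    proof -
      have "(\<Sum>s<n. (X (s + l * 2 ^ Suc j + 2 ^ j) - X (s + l * 2 ^ Suc j))\<^sup>2)
          = (\<Sum>s<n. (X (s + 2 ^ j) - X s)\<^sup>2)"
        by (rule sum_shift_periodic[where F = "\<lambda>s. (X (s + 2 ^ j) - X s)\<^sup>2"])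
           (simp add: X_def mod_add_self_mid)
      then show ?thesis using j by (simp add: hop_def X_def)
    qed
    then show "(\<Sum>l<2 ^ (J - Suc j). \<Sum>s<n. (X (s + l * 2 ^ Suc j + 2 ^ j) - X (s + l * 2 ^ Suc j))\<^sup>2) / r
        + real n * r = 2 ^ (J - Suc j) * hop n x (2 ^ j) / r + real n * r"
      by simp
  qed simp
  also have "\<dots> = real n * (\<Sum>j<J. 2 ^ (J - Suc j) * hop n x (2 ^ j) / (real n * r) + r)"
    unfolding sum_distrib_left by (rule sum.cong) (use n in \<open>auto simp: field_simps\<close>)
  finally show ?thesis using n ab by simp
qed

text \<open>For the least \<open>J\<close> with \<open>n <= 2 ^ J\<close>,
  \<open>(J - 1) / 2 <= (J - 1) * ln 2 <= ln n\<close>, and \<open>1 <= ln n\<close> since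
  \<open>exp 1 <= 3 <= n\<close>; hence the factor 3.\<close>

lemma exists_dyadic_scale:
  assumes "n \<ge> 3"
  obtains J where "2 ^ J < 2 * n" "n \<le> 2 ^ J" "real J \<le> 3 * ln (real n)"
proof -
  define J where "J = (LEAST J. n \<le> 2 ^ J)"
  have J: "n \<le> 2 ^ J" unfolding J_def
    by (rule LeastI[of _ n]) (simp add: less_imp_le)
  obtain I where I: "J = Suc I" using J assms by (cases J) auto
  have "\<not> n \<le> 2 ^ I" using not_less_Least[of I "\<lambda>J. n \<le> 2 ^ J"] I by (simp add: J_def)
  then have less: "2 ^ I < n" by simp
  then have "real (2 ^ I) \<le> real n" by (simp only: of_nat_le_iff less_imp_le)
  then have "ln (real (2 ^ I)) \<le> ln (real n)" using assms by (subst ln_le_cancel_iff) auto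
  then have "real I * ln 2 \<le> ln (real n)" by (simp add: ln_realpow)
  moreover have "ln (2::real) \<ge> 1 / 2" using ln_le_minus_one[of "1/2 :: real"] by (simp add: ln_div)
  then have "real I * (1 / 2) \<le> real I * ln 2" by (intro mult_left_mono) auto
  moreover have "1 \<le> ln (real n)"
  proof -
    have "exp (1::real) \<le> real n" using exp_le assms by linarith
    then show ?thesis using assms by (subst ln_ge_iff) auto
  qed
  ultimately have "real J \<le> 3 * ln (real n)" using I by simp
  then show thesis using that[of J] J less I by simp
qed

subsection \<open>Expectations over the process\<close>

lemma prob_space_cycle_process:
  assumes "prob_space W"
  shows "prob_space (cycle_process n W)"
  unfolding cycle_process_def
  by (intro prob_space_PiM prob_space_pair prob_space_measure_pmf assms)

text \<open>Arbitrary initial loads are allowed, since conditioning on the first step restarts the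
  process from unequal loads.\<close>

primrec run :: "nat \<Rightarrow> (nat \<Rightarrow> real) \<Rightarrow> (nat \<Rightarrow> nat \<times> real) \<Rightarrow> nat \<Rightarrow> (nat \<Rightarrow> real)" where
  "run n x \<omega> 0 = x"
| "run n x \<omega> (Suc t) = balance n (fst (\<omega> t)) (snd (\<omega> t)) (run n x \<omega> t)"

lemma load_eq_run: "load n c \<omega> t = run n (\<lambda>_. c) \<omega> t"
  by (induction t) simp_all

text \<open>The recursion of \<open>run\<close> peels off the last step; this form peels off the
  first, as the induction over expectations requires.\<close>

lemma run_case_nat:
  "run n x (case_nat s \<omega>) (Suc t) = run n (balance n (fst s) (snd s) x) \<omega> t"
  by (induction t) simp_all

lemma measurable_balance:
  assumes "\<And>i. (\<lambda>\<omega>. f \<omega> i) \<in> borel_measurable M" "w \<in> borel_measurable M"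
  shows "(\<lambda>\<omega>. balance n e (w \<omega>) (f \<omega>) i) \<in> borel_measurable M"
  using assms unfolding balance_def Let_def fun_upd_apply by simp

lemma measurable_run:
  assumes "sets W = sets borel"
  shows "(\<lambda>\<omega>. run n x \<omega> t i) \<in> borel_measurable (cycle_process n W)"
proof (induction t arbitrary: i)
  case (Suc t)
  have comp: "(\<lambda>\<omega>. \<omega> t) \<in> cycle_process n W \<rightarrow>\<^sub>M measure_pmf (pmf_of_set {..<n}) \<Otimes>\<^sub>M W"
    unfolding cycle_process_def by measurable
  have fst: "(\<lambda>\<omega>. fst (\<omega> t)) \<in> cycle_process n W \<rightarrow>\<^sub>M count_space UNIV"
    using measurable_compose[OF comp measurable_fst] by simp
  have snd: "(\<lambda>\<omega>. snd (\<omega> t)) \<in> borel_measurable (cycle_process n W)"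
    using measurable_compose[OF comp measurable_snd] measurable_cong_sets[OF refl assms] by blast
  have "(\<lambda>\<omega>. balance n e (snd (\<omega> t)) (run n x \<omega> t) i) \<in> borel_measurable (cycle_process n W)" for e
    by (rule measurable_balance) (use Suc snd in auto)
  from measurable_compose_countable[OF this fst] show ?case by simp
qed simp

lemma measurable_hop:
  assumes "\<And>i. (\<lambda>\<omega>. f \<omega> i) \<in> borel_measurable M"
  shows "(\<lambda>\<omega>. hop n (f \<omega>) k) \<in> borel_measurable M"
  using assms unfolding hop_def by simp

lemma measurable_funpow_hop:
  assumes "\<And>i. (\<lambda>\<omega>. f \<omega> i) \<in> borel_measurable M"
  shows "(\<lambda>\<omega>. (hop_step n ^^ t) (hop n (f \<omega>)) k) \<in> borel_measurable M"
proof (induction t arbitrary: k)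
  case 0
  then show ?case using measurable_hop[OF assms] by simp
next
  case (Suc t)
  then show ?case by (simp add: hop_step_def)
qed

text \<open>Prepending an independent step to the i.i.d. sequence leaves its law unchanged
  (\<open>PiM_iter\<close>); Fubini and the uniform edge law do the rest.\<close>

lemma nn_integral_cycle_process_Suc:
  fixes f :: "(nat \<Rightarrow> nat \<times> real) \<Rightarrow> ennreal"
  assumes n: "n > 0" and W: "prob_space W"
    and f: "f \<in> borel_measurable (cycle_process n W)"
  shows "(\<integral>\<^sup>+\<omega>. f \<omega> \<partial>cycle_process n W)
    = (\<Sum>e<n. \<integral>\<^sup>+w. \<integral>\<^sup>+\<omega>. f (case_nat (e, w) \<omega>) \<partial>cycle_process n W \<partial>W) / real n"
proof -
  define p where "p = measure_pmf (pmf_of_set {..<n})"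
  interpret W: prob_space W by fact
  interpret p: prob_space p unfolding p_def by (rule prob_space_measure_pmf)
  interpret pW: pair_prob_space p W ..
  interpret sequence_space "p \<Otimes>\<^sub>M W" ..
  have S: "cycle_process n W = S" by (simp add: cycle_process_def p_def)
  note [measurable] = f[unfolded S]
  have sfS: "sigma_finite_measure S"
    by (intro prob_space_imp_sigma_finite prob_space_axioms)
  have "(\<integral>\<^sup>+\<omega>. f \<omega> \<partial>S) = (\<integral>\<^sup>+\<omega>. f \<omega> \<partial>distr ((p \<Otimes>\<^sub>M W) \<Otimes>\<^sub>M S) S (\<lambda>(s, \<omega>). case_nat s \<omega>))"
    by (simp only: PiM_iter)
  also have "\<dots> = (\<integral>\<^sup>+z. f (case_nat (fst z) (snd z)) \<partial>((p \<Otimes>\<^sub>M W) \<Otimes>\<^sub>M S))"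
    by (subst nn_integral_distr) (auto simp: split_beta')
  also have "\<dots> = (\<integral>\<^sup>+s. \<integral>\<^sup>+\<omega>. f (case_nat s \<omega>) \<partial>S \<partial>(p \<Otimes>\<^sub>M W))"
    by (subst sigma_finite_measure.nn_integral_fst[OF sfS, symmetric]) auto
  also have "\<dots> = (\<integral>\<^sup>+e. \<integral>\<^sup>+w. \<integral>\<^sup>+\<omega>. f (case_nat (e, w) \<omega>) \<partial>S \<partial>W \<partial>p)"
    by (subst W.nn_integral_fst[symmetric]) auto
  also have "\<dots> = (\<Sum>e<n. \<integral>\<^sup>+w. \<integral>\<^sup>+\<omega>. f (case_nat (e, w) \<omega>) \<partial>S \<partial>W) / real n"
    unfolding p_def using n by (subst nn_integral_pmf_of_set) (auto simp: ennreal_of_nat_eq_real_of_nat)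
  finally show ?thesis unfolding S .
qed

text \<open>Condition on the first step and apply the induction hypothesis to the balanced loads;
  hence \<open>x\<close> is arbitrary. Nonnegative integrals allow an exact formula before
  integrability of the hop sums is known.\<close>

lemma nn_integral_hop_run:
  assumes n: "n \<ge> 3" and W: "real_distribution W" and W2: "integrable W (\<lambda>w. w\<^sup>2)"
  shows "(\<integral>\<^sup>+\<omega>. ennreal (hop n (run n x \<omega> t) k) \<partial>cycle_process n W)
    = ennreal ((hop_step n ^^ t) (hop n x) k
        + (\<integral>w. w\<^sup>2 \<partial>W) * (\<Sum>r<t. (hop_step n ^^ r) (hop_noise n) k))"
proof (induction t arbitrary: x)
  interpret real_distribution W by fact
  {
    case 0
    have "emeasure (cycle_process n W) (space (cycle_process n W)) = 1"
      by (intro prob_space.emeasure_space_1 prob_space_cycle_process prob_space_axioms)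
    then show ?case by simp
  next
    case (Suc t)
    define s where "s = (\<integral>w. w\<^sup>2 \<partial>W)"
    define U where "U = (\<lambda>t. \<Sum>r<t. (hop_step n ^^ r) (hop_noise n) k)"
    define b where "b = (\<lambda>t x. (hop_step n ^^ t) (hop n x) k)"
    have s: "s \<ge> 0" by (simp add: s_def)
    have U: "U t \<ge> 0" for t unfolding U_def by (intro sum_nonneg funpow_hop_noise_nonneg n)
    have b: "b t x \<ge> 0" for t x unfolding b_def by (rule funpow_hop_nonneg[OF n])
    have meas [measurable]: "(\<lambda>w. b t (balance n e w x)) \<in> borel_measurable W" for e
      unfolding b_def by (intro measurable_funpow_hop measurable_balance) auto
    have avg: "(\<Sum>e<n. b t (balance n e w x) + s * U t)
        = real n * (b (Suc t) x + w\<^sup>2 * (hop_step n ^^ t) (hop_noise n) k + s * U t)" for w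
      using avg_funpow_hop_balance[OF n, of t w x k] n
      by (simp add: b_def sum.distrib field_simps)
    have "(\<integral>\<^sup>+\<omega>. ennreal (hop n (run n x \<omega> (Suc t)) k) \<partial>cycle_process n W)
        = (\<Sum>e<n. \<integral>\<^sup>+w. ennreal (b t (balance n e w x) + s * U t) \<partial>W) / real n"
      using n prob_space_axioms
      by (subst nn_integral_cycle_process_Suc)
        (auto simp: run_case_nat Suc b_def s_def U_def simp del: run.simps
          intro!: measurable_compose[OF _ measurable_ennreal] measurable_hop measurable_run)
    \<comment> \<open>The edge sum goes inside the integral first: only the edge average is explicit
      in \<open>w\<close>, through \<open>w^2\<close>.\<close>
    also have "(\<Sum>e<n. \<integral>\<^sup>+w. ennreal (b t (balance n e w x) + s * U t) \<partial>W)
        = (\<integral>\<^sup>+w. ennreal (\<Sum>e<n. b t (balance n e w x) + s * U t) \<partial>W)"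
      using b s U by (subst nn_integral_sum[symmetric]) (auto simp: sum_ennreal simp del: ennreal_plus)
    also have "\<dots> = ennreal (\<integral>w. real n * (b (Suc t) x + w\<^sup>2 * (hop_step n ^^ t) (hop_noise n) k + s * U t) \<partial>W)"
      unfolding avg using W2 b s U funpow_hop_noise_nonneg[OF n]
      by (intro nn_integral_eq_integral) auto
    also have "(\<integral>w. real n * (b (Suc t) x + w\<^sup>2 * (hop_step n ^^ t) (hop_noise n) k + s * U t) \<partial>W)
        = real n * (b (Suc t) x + s * (hop_step n ^^ t) (hop_noise n) k + s * U t)"
      using W2 prob_space by (simp add: s_def)
    also have "ennreal \<dots> / real n = ennreal (b (Suc t) x + s * (hop_step n ^^ t) (hop_noise n) k + s * U t)"
      using n b s U funpow_hop_noise_nonneg[OF n]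
      by (simp add: ennreal_of_nat_eq_real_of_nat divide_ennreal)
    also have "b (Suc t) x + s * (hop_step n ^^ t) (hop_noise n) k + s * U t = b (Suc t) x + s * U (Suc t)"
      by (simp add: U_def distrib_left)
    finally show ?case unfolding b_def s_def U_def .
  }
qed

text \<open>From equal loads the homogeneous part of the exact formula vanishes, leaving the second
  moment of \<open>W\<close> times the accumulated noise. Finiteness of this value yields
  integrability.\<close>

lemma expectation_hop_load:
  assumes n: "n \<ge> 3" and W: "real_distribution W" and W2: "integrable W (\<lambda>w. w\<^sup>2)"
    and le1: "(\<integral>w. w\<^sup>2 \<partial>W) \<le> 1" and k: "0 < k" "k < n"
  shows "integrable (cycle_process n W) (\<lambda>\<omega>. hop n (load n c \<omega> t) k)"
    and "(\<integral>\<omega>. hop n (load n c \<omega> t) k \<partial>cycle_process n W) \<le> real k * real n"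
proof -
  interpret real_distribution W by fact
  define U where "U = (\<Sum>r<t. (hop_step n ^^ r) (hop_noise n) k)"
  have U: "0 \<le> U" "U \<le> real k * real n"
    unfolding U_def by (auto intro!: sum_nonneg funpow_hop_noise_nonneg sum_funpow_hop_noise_le n k)
  have "(\<integral>\<^sup>+\<omega>. ennreal (hop n (load n c \<omega> t) k) \<partial>cycle_process n W) = ennreal ((\<integral>w. w\<^sup>2 \<partial>W) * U)"
    using nn_integral_hop_run[OF n W W2, of "\<lambda>_. c" t k]
    by (simp add: load_eq_run U_def funpow_hop_const)
  moreover have "(\<lambda>\<omega>. hop n (load n c \<omega> t) k) \<in> borel_measurable (cycle_process n W)"
    unfolding load_eq_run by (intro measurable_hop measurable_run) simp
  ultimately have "integrable (cycle_process n W) (\<lambda>\<omega>. hop n (load n c \<omega> t) k) \<and>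
      (\<integral>\<omega>. hop n (load n c \<omega> t) k \<partial>cycle_process n W) = (\<integral>w. w\<^sup>2 \<partial>W) * U"
    using U by (subst nn_integral_eq_integrable[symmetric]) (auto simp: hop_nonneg)
  moreover have "(\<integral>w. w\<^sup>2 \<partial>W) * U \<le> 1 * (real k * real n)"
    using U le1 by (intro mult_mono) auto
  ultimately show "integrable (cycle_process n W) (\<lambda>\<omega>. hop n (load n c \<omega> t) k)"
    "(\<integral>\<omega>. hop n (load n c \<omega> t) k \<partial>cycle_process n W) \<le> real k * real n" by auto
qed

theorem theorem1:
  "\<exists>C::real. \<forall>(n::nat) (W::real measure) (c::real) (t::nat).
     n \<ge> 3 \<longrightarrow> real_distribution W \<longrightarrow>
     integrable W (\<lambda>w. w\<^sup>2) \<longrightarrow> (\<integral>w. w\<^sup>2 \<partial>W) \<le> 1 \<longrightarrow>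
     integrable (cycle_process n W) (gap n c t) \<and>
     (\<integral>\<omega>. gap n c t \<omega> \<partial>cycle_process n W) \<le> C * sqrt (real n) * ln (real n)"
proof (intro exI[of _ 6] allI impI)
  fix n :: nat and W :: "real measure" and c :: real and t :: nat
  assume n: "n \<ge> 3" and W: "real_distribution W" and W2: "integrable W (\<lambda>w. w\<^sup>2)"
    and le1: "(\<integral>w. w\<^sup>2 \<partial>W) \<le> 1"
  interpret real_distribution W by fact
  obtain J where J: "2 ^ J < 2 * n" "n \<le> 2 ^ J" "real J \<le> 3 * ln (real n)"
    using exists_dyadic_scale[OF n] .
  define P where "P = cycle_process n W"
  \<comment> \<open>This choice balances the chaining bound: in expectation both of its terms are at
    most \<open>sqrt n\<close> at each scale.\<close>
  define r where "r = sqrt (real n)"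
  have r: "r > 0" "r * r = real n" using n by (auto simp: r_def)
  interpret P: prob_space P
    unfolding P_def by (intro prob_space_cycle_process prob_space_axioms)
  define h where "h = (\<lambda>\<omega> j. hop n (load n c \<omega> t) (2 ^ j))"
  define F where "F = (\<lambda>\<omega>. \<Sum>j<J. 2 ^ (J - Suc j) * h \<omega> j / (real n * r) + r)"
  have scale: "2 ^ j < n" if "j < J" for j
  proof -
    have "(2::nat) ^ Suc j \<le> 2 ^ J" using that by (intro power_increasing) auto
    then show ?thesis using J by simp
  qed
  have h_int: "integrable P (\<lambda>\<omega>. h \<omega> j)" if "j < J" for j
    unfolding h_def P_def using scale[OF that] by (intro expectation_hop_load n W W2 le1) auto
  have h_le: "(\<integral>\<omega>. h \<omega> j \<partial>P) \<le> 2 ^ j * real n" if "j < J" for j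
    using expectation_hop_load(2)[OF n W W2 le1, of "2 ^ j" c t] scale[OF that]
    by (simp add: h_def P_def)
  have F_int: "integrable P F"
    unfolding F_def using h_int by (intro Bochner_Integration.integrable_sum) auto
  have gap_le: "gap n c t \<omega> \<le> F \<omega>" for \<omega>
    unfolding gap_def F_def h_def using max_minus_min_le_hops[OF J(1,2) r(1)] .
  have gap_nonneg: "gap n c t \<omega> \<ge> 0" for \<omega>
  proof -
    have "load n c \<omega> t 0 \<in> load n c \<omega> t ` {..<n}" using n by auto
    then have "Min (load n c \<omega> t ` {..<n}) \<le> load n c \<omega> t 0"
      "load n c \<omega> t 0 \<le> Max (load n c \<omega> t ` {..<n})" by (auto intro: Min_le Max_ge)
    then show ?thesis unfolding gap_def by linarith
  qed
  have "(\<lambda>\<omega>. load n c \<omega> t i) \<in> borel_measurable P" for i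
    unfolding load_eq_run P_def by (rule measurable_run) simp
  then have meas: "gap n c t \<in> borel_measurable P"
    unfolding gap_def[abs_def] by (intro borel_measurable_diff borel_measurable_Max borel_measurable_Min) auto
  have int: "integrable P (gap n c t)"
    by (rule Bochner_Integration.integrable_bound[OF F_int meas])
       (use gap_le gap_nonneg in \<open>auto intro!: AE_I2 order_trans[OF gap_le abs_ge_self]\<close>)
  have "(\<integral>\<omega>. gap n c t \<omega> \<partial>P) \<le> (\<integral>\<omega>. F \<omega> \<partial>P)"
    by (intro integral_mono int F_int gap_le)
  also have "\<dots> = (\<Sum>j<J. 2 ^ (J - Suc j) * (\<integral>\<omega>. h \<omega> j \<partial>P) / (real n * r) + r)"
    unfolding F_def using h_int
    by (subst Bochner_Integration.integral_sum) (auto simp: P.prob_space)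
  also have "\<dots> \<le> (\<Sum>j<J. r + r)"
  proof (rule sum_mono)
    fix j assume "j \<in> {..<J}"
    then have j: "j < J" by simp
    have pow: "(2::real) ^ (J - Suc j) * 2 ^ j = 2 ^ J / 2"
    proof -
      have "(2::real) ^ J = 2 ^ (J - Suc j + Suc j)" using j by simp
      then show ?thesis by (simp only: power_add) simp
    qed
    have "(2::real) ^ J \<le> 2 * real n"
      using J(1) by (metis less_imp_le of_nat_le_iff of_nat_mult of_nat_numeral of_nat_power)
    \<comment> \<open>The number of blocks times the hop bound is \<open>2 ^ (J - 1) * n\<close> at
      every scale, so no scale dominates.\<close>
    have "2 ^ (J - Suc j) * (\<integral>\<omega>. h \<omega> j \<partial>P) \<le> 2 ^ (J - Suc j) * (2 ^ j * real n)"
      using h_le[OF j] by (intro mult_left_mono) auto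
    also have "\<dots> = 2 ^ J / 2 * real n" by (simp add: pow flip: mult.assoc)
    also have "\<dots> \<le> real n * real n"
      using \<open>2 ^ J \<le> 2 * real n\<close> by (intro mult_right_mono) auto
    also have "\<dots> = r * (real n * r)" using r(2) by (metis mult.assoc mult.commute)
    finally have "2 ^ (J - Suc j) * (\<integral>\<omega>. h \<omega> j \<partial>P) / (real n * r) \<le> r"
      using r n by (subst pos_divide_le_eq) auto
    then show "2 ^ (J - Suc j) * (\<integral>\<omega>. h \<omega> j \<partial>P) / (real n * r) + r \<le> r + r" by simp
  qed
  also have "\<dots> = 2 * r * real J" by simp
  \<comment> \<open>At most \<open>3 * ln n\<close> scales of cost \<open>2 * r\<close> give the
    constant 6.\<close>
  also have "\<dots> \<le> 2 * r * (3 * ln (real n))"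
    using J(3) r by (intro mult_left_mono) auto
  also have "\<dots> = 6 * sqrt (real n) * ln (real n)" by (simp add: r_def)
  finally show "integrable (cycle_process n W) (gap n c t) \<and>
     (\<integral>\<omega>. gap n c t \<omega> \<partial>cycle_process n W) \<le> 6 * sqrt (real n) * ln (real n)"
    using int by (simp add: P_def)
qed

end
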